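(* Let $T$ be a starlike tree of odd order $n=2p+1$. Then $RE(T)\leq RE(S^p)$, where $S^p$ is the $p$-sun (which has the same order $n$).
   Context: Graphs are finite, simple and undirected. For a graph $G$ with vertex set $V$, edge set $E$ and vertex degrees $d_u$, the Randić matrix $R=[r_{uv}]$ is the real symmetric matrix indexed by $V$ with $r_{uv}=1/\sqrt{d_ud_v}$ if $uv\in E$ and $r_{uv}=0$ otherwise. The Randić energy is $RE(G)=\sum_{i=1}^n|\lambda_i|$, where $\lambda_1,\dots,\lambda_n$ are the eigenvalues of $R$ with multiplicity. A starlike tree is a tree with exactly one vertex of degree greater than $2$. The $p$-sun $S^p$ is the tree of order $2p+1$ obtained from the star on $p+1$ vertices (one center joined to $p$ leaves) by subdividing each edge once. *)

theory Defs
  imports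
    Complex_Main
    "Graph_Theory.Pair_Digraph"
    "Graph_Theory.Digraph_Component"
    "Jordan_Normal_Form.Char_Poly"
begin

text \<open>
  A finite simple undirected graph is a symmetric, loop-free finite digraph without parallel arcs
  (locale \<open>pair_graph\<close>): the edge \<open>uv\<close> is the pair of arcs \<open>(u,v)\<close>, \<open>(v,u)\<close>. The degree of a
  vertex is therefore its out-degree, and an edge traversed back and forth is a directed cycle of
  length 2, which is why the library's \<open>forest\<close> and \<open>tree\<close> cannot be used for such graphs.
\<close>

definition degree_of :: "'a pair_pre_digraph \<Rightarrow> 'a \<Rightarrow> nat" where
  "degree_of G v = out_degree (with_proj G) v"

definition is_tree :: "'a pair_pre_digraph \<Rightarrow> bool" where
  "is_tree G \<longleftrightarrow> pair_graph G \<and> Digraph_Component.connected (with_proj G) \<and>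
     \<not> (\<exists>c. pre_digraph.cycle (with_proj G) c \<and> length c \<ge> 3)"

definition starlike_tree :: "'a pair_pre_digraph \<Rightarrow> bool" where
  "starlike_tree G \<longleftrightarrow> is_tree G \<and> (\<exists>!v. v \<in> pverts G \<and> degree_of G v > 2)"

definition star_graph :: "nat \<Rightarrow> nat pair_pre_digraph" where
  "star_graph p = \<lparr>pverts = {0..p}, parcs = (\<lambda>i. (0, i)) ` {1..p} \<union> (\<lambda>i. (i, 0)) ` {1..p}\<rparr>"

text \<open>The new vertex \<open>p + i\<close> subdivides the edge joining the center \<open>0\<close> to the leaf \<open>i\<close>.\<close>

definition sun_graph :: "nat \<Rightarrow> nat pair_pre_digraph" where
  "sun_graph p = fold (\<lambda>i G. subdivide G (0, i) (p + i)) [1..<Suc p] (star_graph p)"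

lemma sun_graph_explicit:
  "sun_graph p = \<lparr>pverts = {0..2 * p},
     parcs = (\<Union>i\<in>{1..p}. {(0, p + i), (p + i, 0), (p + i, i), (i, p + i)})\<rparr>"
proof -
  have "fold (\<lambda>i G. subdivide G (0, i) (p + i)) [1..<Suc k] (star_graph p) =
    \<lparr>pverts = {0..p + k},
     parcs = (\<Union>i\<in>{k<..p}. {(0, i), (i, 0)}) \<union>
       (\<Union>i\<in>{1..k}. {(0, p + i), (p + i, 0), (p + i, i), (i, p + i)})\<rparr>" if "k \<le> p" for k
    using that
  proof (induction k)
    case 0
    show ?case by (auto simp: star_graph_def greaterThanAtMost_def)
  next
    case (Suc k)
    let ?old = "\<lambda>k. (\<Union>i\<in>{k<..p}. {(0, i), (i, 0)}) :: nat rel"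
    let ?new = "\<lambda>k. (\<Union>i\<in>{1..k}. {(0, p + i), (p + i, 0), (p + i, i), (i, p + i)}) :: nat rel"
    have "{k<..p} = insert (Suc k) {Suc k<..p}" using Suc.prems by auto
    then have old: "?old k - {(0, Suc k), (Suc k, 0)} = ?old (Suc k)" by auto
    have new: "?new (Suc k) =
        ?new k \<union> {(0, p + Suc k), (p + Suc k, 0), (p + Suc k, Suc k), (Suc k, p + Suc k)}"
      by (simp add: atLeastAtMostSuc_conv Un_commute)
    have disj: "?new k - {(0, Suc k), (Suc k, 0)} = ?new k" using Suc.prems by auto
    have "fold (\<lambda>i G. subdivide G (0, i) (p + i)) [1..<Suc (Suc k)] (star_graph p) =
        subdivide \<lparr>pverts = {0..p + k}, parcs = ?old k \<union> ?new k\<rparr> (0, Suc k) (p + Suc k)"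
      using Suc by (simp del: upt_Suc add: upt_Suc_append)
    also have "\<dots> = \<lparr>pverts = {0..p + k} \<union> {p + Suc k}, parcs = ?old (Suc k) \<union> ?new (Suc k)\<rparr>"
      unfolding subdivide.simps new by (simp only: pair_pre_digraph.simps Un_Diff old disj) blast
    also have "{0..p + k} \<union> {p + Suc k} = {0..p + Suc k}" by auto
    finally show ?case .
  qed
  from this[of p] show ?thesis by (simp only: sun_graph_def mult_2) simp
qed

definition randic_entry :: "'a pair_pre_digraph \<Rightarrow> 'a \<Rightarrow> 'a \<Rightarrow> real" where
  "randic_entry G u v =
     (if (u, v) \<in> parcs G then 1 / sqrt (real (degree_of G u) * real (degree_of G v)) else 0)"

text \<open>The matrix indexed by the vertices, listed in the order \<open>f 0, f 1, \<dots>\<close>.\<close>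

definition randic_matrix_wrt :: "(nat \<Rightarrow> 'a) \<Rightarrow> 'a pair_pre_digraph \<Rightarrow> real mat" where
  "randic_matrix_wrt f G =
     Matrix.mat (card (pverts G)) (card (pverts G)) (\<lambda>(i, j). randic_entry G (f i) (f j))"

definition randic_matrix :: "'a pair_pre_digraph \<Rightarrow> real mat" where
  "randic_matrix G =
     randic_matrix_wrt (SOME f. bij_betw f {..<card (pverts G)} (pverts G)) G"

text \<open>The matrix is real symmetric, so all its eigenvalues are real.\<close>

definition randic_energy :: "'a pair_pre_digraph \<Rightarrow> real" where
  "randic_energy G =
     (\<Sum>x | eigenvalue (randic_matrix G) x.
        real (Polynomial.order x (char_poly (randic_matrix G))) * \<bar>x\<bar>)"

text \<open>The spectrum does not depend on the chosen enumeration of the vertices.\<close>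

lemma char_poly_randic_matrix:
  assumes fin: "finite (pverts G)" and f: "bij_betw f {..<card (pverts G)} (pverts G)"
  shows "char_poly (randic_matrix G) = char_poly (randic_matrix_wrt f G)"
proof -
  define n where "n = card (pverts G)"
  define g where "g = (SOME f. bij_betw f {..<card (pverts G)} (pverts G))"
  have g: "bij_betw g {..<n} (pverts G)"
    using someI[of "\<lambda>f. bij_betw f {..<card (pverts G)} (pverts G)", OF f]
    by (simp add: g_def n_def)
  have f': "bij_betw f {..<n} (pverts G)" using f by (simp add: n_def)
  define s where "s = the_inv_into {..<n} f \<circ> g"
  have s: "bij_betw s {..<n} {..<n}"
    unfolding s_def using g bij_betw_the_inv_into[OF f'] by (rule bij_betw_trans)
  have sn: "s i < n" if "i < n" for i using s that by (auto simp: bij_betw_def)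
  have fs: "f (s i) = g i" if "i < n" for i
    using f_the_inv_into_f_bij_betw[OF f'] g that unfolding s_def by (auto simp: bij_betw_def)
  have sinj: "s i = s j \<longleftrightarrow> i = j" if "i < n" "j < n" for i j
    using s that by (auto simp: bij_betw_def inj_on_def)
  define A where "A = randic_matrix_wrt g G"
  define B where "B = randic_matrix_wrt f G"
  define P where "P = (Matrix.mat n n (\<lambda>(i, j). if s i = j then 1 else 0) :: real mat)"
  define Q where "Q = (Matrix.mat n n (\<lambda>(i, j). if s j = i then 1 else 0) :: real mat)"
  have carr: "A \<in> carrier_mat n n" "B \<in> carrier_mat n n" "P \<in> carrier_mat n n" "Q \<in> carrier_mat n n"
    by (auto simp: A_def B_def P_def Q_def randic_matrix_wrt_def n_def)
  have PQ: "P * Q = 1\<^sub>m n"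
    by (rule eq_matI)
       (auto simp: P_def Q_def scalar_prod_def sn sinj if_distrib[of "\<lambda>x. x * _"] sum.delta cong: if_cong)
  have QP: "Q * P = 1\<^sub>m n"
    using mat_mult_left_right_inverse[OF carr(3,4) PQ] .
  have PB: "P * B = A * P"
  proof (rule eq_matI)
    fix i j assume ij: "i < dim_row (A * P)" "j < dim_col (A * P)"
    then have ij: "i < n" "j < n" using carr by auto
    have "j \<in> s ` {..<n}" using s ij(2) by (simp add: bij_betw_def)
    then obtain k where k: "k < n" "s k = j" by auto
    have sk: "s x = j \<longleftrightarrow> x = k" if "x < n" for x using sinj[OF that k(1)] k(2) by simp
    have "(P * B) $$ (i, j) = (\<Sum>x = 0..<n. (if s i = x then 1 else 0) * randic_entry G (f x) (f j))"
      using ij carr by (simp add: scalar_prod_def P_def B_def randic_matrix_wrt_def n_def)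
    also have "\<dots> = randic_entry G (f (s i)) (f j)"
      using sn[OF ij(1)] by (simp add: if_distrib[of "\<lambda>x. x * _"] sum.delta cong: if_cong)
    also have "\<dots> = randic_entry G (g i) (g k)" using fs[OF ij(1)] fs[OF k(1)] k(2) by simp
    also have "\<dots> = (\<Sum>x = 0..<n. randic_entry G (g i) (g x) * (if x = k then 1 else 0))"
      using k(1) by (simp add: if_distrib[of "\<lambda>x. _ * x"] sum.delta cong: if_cong)
    also have "\<dots> = (\<Sum>x = 0..<n. randic_entry G (g i) (g x) * (if s x = j then 1 else 0))"
      by (rule sum.cong) (auto simp: sk)
    also have "\<dots> = (A * P) $$ (i, j)"
      using ij carr by (simp add: scalar_prod_def P_def A_def randic_matrix_wrt_def n_def)
    finally show "(P * B) $$ (i, j) = (A * P) $$ (i, j)" .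
  qed (use carr in auto)
  have "P * B * Q = A * (P * Q)" using PB carr by (metis assoc_mult_mat)
  then have "A = P * B * Q" using PQ carr by simp
  then have "similar_mat_wit A B P Q"
    using carr PQ QP by (intro similar_mat_witI[of _ _ n]) assumption+
  then have "similar_mat A B" unfolding similar_mat_def by blast
  then show ?thesis
    using char_poly_similar unfolding A_def B_def g_def randic_matrix_def by blast
qed

end

theory Submission
  imports Defs "Jordan_Normal_Form.Schur_Decomposition"
begin

text \<open>
  Let \<open>n = 2 * p + 1\<close> be the order of the starlike tree. The tree is bipartite, so its Randic matrix has
  the eigenvalues \<open>1\<close> and \<open>-1\<close>, and, the order being odd, also \<open>0\<close>. The remaining \<open>2 * p - 2\<close> eigenvalues
  \<open>e\<close> satisfy \<open>sqrt 2 * \<bar>e\<bar> \<le> e\<^sup>2 + 1 / 2\<close>, which bounds the energy by the trace of the squared matrix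
  (\<open>bipartite_randic_spectrum\<close>, \<open>bipartite_randic_energy_le\<close>). If this trace, the sum of
  \<open>1 / (d u * d v)\<close> over all arcs \<open>(u, v)\<close>, is at most \<open>p + 1\<close>, then the energy is at most
  \<open>2 + sqrt 2 * (p - 1)\<close>.

  The trace bound (\<open>sum_sq_randic_le\<close>) comes from the inequality
  \<open>(1 / d u - 1 / 2) * (1 / d v - 1 / 2) \<le> 0\<close>, which holds for every edge of a starlike tree: no edge
  joins two leaves, and no edge joins two vertices of degree greater than two. Summing it over all
  arcs bounds the trace by \<open>n\<close> minus half the number of edges, and a connected graph has at least
  \<open>n - 1\<close> edges.

  Finally the sun attains the bound (\<open>randic_energy_sun\<close>): the traces of the second and the fourth power
  of its Randic matrix force \<open>e\<^sup>2 = 1 / 2\<close> for all eigenvalues \<open>e\<close> other than \<open>1\<close>, \<open>-1\<close>, \<open>0\<close>.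
\<close>

section \<open>Spectra of real symmetric matrices\<close>

definition trace_mat :: "'a :: comm_ring_1 mat \<Rightarrow> 'a" where
  "trace_mat A = (\<Sum>i<dim_row A. A $$ (i, i))"

lemma trace_mult:
  assumes "A \<in> carrier_mat n m" "B \<in> carrier_mat m n"
  shows "trace_mat (A * B) = (\<Sum>i<n. \<Sum>j<m. A $$ (i, j) * B $$ (j, i))"
  using assms by (auto simp: trace_mat_def scalar_prod_def lessThan_atLeast0 intro!: sum.cong)

lemma trace_mult_comm:
  assumes A: "A \<in> carrier_mat n m" and B: "B \<in> carrier_mat m n"
  shows "trace_mat (A * B) = trace_mat (B * A)"
  unfolding trace_mult[OF A B] trace_mult[OF B A]
  by (subst sum.swap) (simp add: mult.commute)

lemma trace_similar:
  assumes "similar_mat_wit A B P Q"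
  shows "trace_mat A = trace_mat B"
proof -
  define n where "n = dim_row A"
  note wit = similar_mat_witD[OF n_def assms]
  have "trace_mat A = trace_mat (P * (B * Q))"
    using wit by (simp add: assoc_mult_mat[of _ n n _ n _ n])
  also have "\<dots> = trace_mat (B * Q * P)"
    using wit by (intro trace_mult_comm) auto
  also have "B * Q * P = B"
    using wit by (simp add: assoc_mult_mat[of _ n n _ n _ n])
  finally show ?thesis .
qed

lemma upper_triangular_pow_mat:
  fixes B :: "'a :: comm_ring_1 mat"
  assumes B: "B \<in> carrier_mat n n" and tri: "upper_triangular B"
  shows "upper_triangular (B ^\<^sub>m k) \<and> (\<forall>i<n. (B ^\<^sub>m k) $$ (i, i) = B $$ (i, i) ^ k)"
proof (induction k)
  case 0
  show ?case using B by auto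
next
  case (Suc k)
  define C where "C = B ^\<^sub>m k"
  have C: "C \<in> carrier_mat n n" using B by (simp add: C_def)
  have entry: "(C * B) $$ (i, j) = (\<Sum>l = 0..<n. C $$ (i, l) * B $$ (l, j))"
    if "i < n" "j < n" for i j
    using that B C by (simp add: scalar_prod_def)
  have zero: "C $$ (i, l) * B $$ (l, j) = 0"
    if "i < n" "l < n" "j \<le> i" "j < i \<or> l \<noteq> i" for i j l
    using that Suc.IH tri B C upper_triangularD[of C l i] upper_triangularD[of B j l]
    by (cases "l < i") (auto simp: C_def[symmetric])
  have "(C * B) $$ (i, j) = 0" if "j < i" "i < n" for i j
    using that zero by (auto simp: entry intro!: sum.neutral)
  moreover have "(C * B) $$ (i, i) = C $$ (i, i) * B $$ (i, i)" if "i < n" for i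
  proof -
    have "(\<Sum>l = 0..<n. C $$ (i, l) * B $$ (l, i)) = (\<Sum>l\<in>{i}. C $$ (i, l) * B $$ (l, i))"
      using that zero by (intro sum.mono_neutral_right) auto
    then show ?thesis using that by (simp add: entry)
  qed
  ultimately show ?case
    using Suc.IH B C by (auto simp: C_def[symmetric] mult.commute)
qed

text \<open>Schur triangularisation: powers of an upper triangular matrix have the powers of its diagonal
  entries on the diagonal, and the trace is invariant under similarity.\<close>

lemma trace_pow_mat:
  fixes A :: "'a :: conjugatable_ordered_field mat"
  assumes A: "A \<in> carrier_mat n n" and es: "char_poly A = (\<Prod>e\<leftarrow>es. [:- e, 1:])"
  shows "trace_mat (A ^\<^sub>m k) = (\<Sum>e\<leftarrow>es. e ^ k)"
proof -
  obtain B P Q where BPQ: "schur_decomposition A es = (B, P, Q)" by (metis prod_cases3)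
  then have wit: "similar_mat_wit A B P Q" and tri: "upper_triangular B" and diag: "diag_mat B = es"
    using schur_decomposition[OF A es] by auto
  have B: "B \<in> carrier_mat n n"
    using similar_mat_witD2[OF A wit] by blast
  have "trace_mat (A ^\<^sub>m k) = trace_mat (B ^\<^sub>m k)"
    by (rule trace_similar[OF similar_mat_wit_pow[OF wit]])
  also have "\<dots> = (\<Sum>i<n. B $$ (i, i) ^ k)"
    using upper_triangular_pow_mat[OF B tri, of k] B by (simp add: trace_mat_def)
  also have "\<dots> = (\<Sum>e\<leftarrow>diag_mat B. e ^ k)"
    using B by (simp add: diag_mat_def sum_list_distinct_conv_sum_set o_def lessThan_atLeast0)
  finally show ?thesis by (simp add: diag)
qed

text \<open>For an eigenvector \<open>v\<close> the Hermitian form \<open>S = v\<^sup>* A v\<close> is its own conjugate, hence real, and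
  it equals \<open>z\<close> times the positive number \<open>N = v\<^sup>* v\<close>.\<close>

lemma real_symmetric_complex_eigenvalue:
  fixes A :: "real mat"
  assumes A: "A \<in> carrier_mat n n"
    and sym: "\<And>i j. i < n \<Longrightarrow> j < n \<Longrightarrow> A $$ (i, j) = A $$ (j, i)"
    and ev: "eigenvalue (map_mat of_real A) (z :: complex)"
  shows "z \<in> \<real>"
proof -
  let ?C = "map_mat of_real A :: complex mat"
  obtain v where v: "v \<in> carrier_vec n" "v \<noteq> 0\<^sub>v n" "?C *\<^sub>v v = z \<cdot>\<^sub>v v"
    using ev A unfolding eigenvalue_def eigenvector_def by auto
  define S where "S = (\<Sum>i<n. \<Sum>j<n. cnj (v $ i) * of_real (A $$ (i, j)) * v $ j)"
  define N where "N = (\<Sum>i<n. cmod (v $ i) ^ 2)"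
  have row: "(\<Sum>j<n. of_real (A $$ (i, j)) * v $ j) = z * v $ i" if "i < n" for i
  proof -
    have "(?C *\<^sub>v v) $ i = (\<Sum>j<n. of_real (A $$ (i, j)) * v $ j)"
      using that A v(1) by (simp add: scalar_prod_def lessThan_atLeast0)
    then show ?thesis using that v by simp
  qed
  have "S = (\<Sum>i<n. cnj (v $ i) * (\<Sum>j<n. of_real (A $$ (i, j)) * v $ j))"
    by (simp add: S_def sum_distrib_left mult.assoc)
  also have "\<dots> = (\<Sum>i<n. z * (cnj (v $ i) * v $ i))"
    by (intro sum.cong) (simp_all add: row)
  also have "\<dots> = z * of_real N"
    by (simp add: N_def sum_distrib_left complex_norm_square mult.commute del: of_real_power)
  finally have SN: "S = z * of_real N" .
  have "cnj S = (\<Sum>i<n. \<Sum>j<n. cnj (v $ j) * of_real (A $$ (j, i)) * v $ i)"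
    by (auto simp: S_def sym mult_ac intro!: sum.cong)
  also have "\<dots> = S" by (subst sum.swap) (simp add: S_def)
  finally have "S \<in> \<real>" by (simp add: Reals_cnj_iff)
  moreover have "N \<noteq> 0"
  proof
    assume "N = 0"
    then have "\<forall>i\<in>{..<n}. cmod (v $ i) ^ 2 = 0"
      unfolding N_def by (subst (asm) sum_nonneg_eq_0_iff) auto
    then have "v = 0\<^sub>v n" using v(1) by (intro eq_vecI) auto
    then show False using v(2) by simp
  qed
  ultimately have "S / of_real N \<in> \<real>" by simp
  then show ?thesis using SN \<open>N \<noteq> 0\<close> by simp
qed

lemma real_symmetric_char_poly_splits:
  fixes A :: "real mat"
  assumes A: "A \<in> carrier_mat n n"
    and sym: "\<And>i j. i < n \<Longrightarrow> j < n \<Longrightarrow> A $$ (i, j) = A $$ (j, i)"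
  obtains es where "char_poly A = (\<Prod>e\<leftarrow>es. [:- e, 1:])" "length es = n"
proof -
  interpret cp: map_poly_inj_idom_hom complex_of_real ..
  let ?C = "map_mat of_real A :: complex mat"
  have C: "?C \<in> carrier_mat n n" using A by simp
  obtain zs where zs: "char_poly ?C = (\<Prod>z\<leftarrow>zs. [:- z, 1:])" "length zs = n"
    using char_poly_factorized[OF C] by blast
  have real: "of_real (Re z) = z" if "z \<in> set zs" for z
  proof -
    have "poly (char_poly ?C) z = 0" unfolding zs(1) poly_prod_list
      using that by (auto simp: prod_list_zero_iff image_iff)
    then have "eigenvalue ?C z" using eigenvalue_root_char_poly[OF C] by blast
    from real_symmetric_complex_eigenvalue[OF A sym this] show ?thesis by simp
  qed
  have "map_poly of_real (char_poly A) = char_poly ?C"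
    by (rule of_real_hom.char_poly_hom[OF A, symmetric])
  also have "\<dots> = (\<Prod>z\<leftarrow>zs. [:- complex_of_real (Re z), 1:])"
    unfolding zs(1) using real by (intro arg_cong[of _ _ prod_list] map_cong) auto
  also have "\<dots> = map_poly of_real (\<Prod>e\<leftarrow>map Re zs. [:- e, 1:])"
    by (simp add: cp.hom_prod_list o_def)
  finally have "char_poly A = (\<Prod>e\<leftarrow>map Re zs. [:- e, 1:])"
    using cp.injectivity by blast
  then show ?thesis using zs(2) by (intro that[of "map Re zs"]) simp_all
qed

lemma order_prod_linear_factors:
  fixes es :: "'a :: field list"
  shows "Polynomial.order x (\<Prod>e\<leftarrow>es. [:- e, 1:]) = count (mset es) x"
proof (induction es)
  case (Cons e es)
  have "(\<Prod>e\<leftarrow>es. [:- e, 1:]) \<noteq> 0" by (auto simp: prod_list_zero_iff)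
  then have "[:- e, 1:] * (\<Prod>e\<leftarrow>es. [:- e, 1:]) \<noteq> 0" by (simp only: mult_eq_0_iff) auto
  then have "Polynomial.order x ([:- e, 1:] * (\<Prod>e\<leftarrow>es. [:- e, 1:])) =
     Polynomial.order x [:- e, 1:] + Polynomial.order x (\<Prod>e\<leftarrow>es. [:- e, 1:])"
    by (rule order_mult)
  also have "Polynomial.order x [:- e, 1:] = (if x = e then 1 else 0)"
    using order_power_n_n[of e 1] by (auto intro: order_0I)
  finally show ?case using Cons.IH by simp
qed (simp add: order_0I)

text \<open>With \<open>h = abs\<close> this turns the energy into a plain sum over the list of roots, on which the
  three known eigenvalues can be split off and the power sums can be read as traces.\<close>

lemma sum_eigenvalues_weighted_by_order:
  fixes A :: "real mat"
  assumes A: "A \<in> carrier_mat n n" and es: "char_poly A = (\<Prod>e\<leftarrow>es. [:- e, 1:])"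
  shows "(\<Sum>x | eigenvalue A x. real (Polynomial.order x (char_poly A)) * h x) =
    sum_list (map h es)"
proof -
  have "eigenvalue A x \<longleftrightarrow> x \<in> set es" for x
    unfolding eigenvalue_root_char_poly[OF A] es poly_prod_list
    by (auto simp: prod_list_zero_iff image_iff)
  then have "(\<Sum>x | eigenvalue A x. real (Polynomial.order x (char_poly A)) * h x) =
    (\<Sum>x\<in>set es. real (count (mset es) x) * h x)"
    by (simp add: es order_prod_linear_factors)
  also have "\<dots> = sum_list (map h es)"
  proof (induction es)
    case (Cons e es)
    have "(\<Sum>x\<in>set (e # es). real (count (mset (e # es)) x) * h x) =
      (\<Sum>x\<in>insert e (set es). real (count (mset es) x) * h x) + (\<Sum>x\<in>insert e (set es). if x = e then h x else 0)"
      by (subst sum.distrib[symmetric], rule sum.cong) (auto simp: algebra_simps)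
    also have "(\<Sum>x\<in>insert e (set es). real (count (mset es) x) * h x) = (\<Sum>x\<in>set es. real (count (mset es) x) * h x)"
      by (intro sum.mono_neutral_right) (auto simp: not_in_iff)
    also have "(\<Sum>x\<in>insert e (set es). if x = e then h x else 0) = h e" by simp
    finally show ?case using Cons.IH by simp
  qed simp
  finally show ?thesis .
qed

section \<open>The Randic spectrum of a bipartite graph\<close>

lemma degree_of_eq_card:
  "degree_of G u = card {v. (u, v) \<in> parcs G}"
proof -
  have "out_arcs (with_proj G) u = Pair u ` {v. (u, v) \<in> parcs G}"
    by (auto simp: out_arcs_def)
  then show ?thesis
    by (simp add: degree_of_def out_degree_def card_image inj_on_def)
qed

lemma (in pair_graph) degree_of_eq_sum:
  assumes "u \<in> pverts G"
  shows "real (degree_of G u) = (\<Sum>v\<in>pverts G. if (u, v) \<in> parcs G then 1 else 0)"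
proof -
  have "{v. (u, v) \<in> parcs G} = {v \<in> pverts G. (u, v) \<in> parcs G}"
    using in_arcsD2 by auto
  then show ?thesis
    by (simp add: degree_of_eq_card sum.If_cases pair_finite_verts Int_def)
qed

lemma (in pair_graph) degree_of_pos:
  assumes "(u, v) \<in> parcs G"
  shows "degree_of G u > 0"
proof -
  have "{v. (u, v) \<in> parcs G} \<subseteq> pverts G" using in_arcsD2 by auto
  then have "finite {v. (u, v) \<in> parcs G}" using pair_finite_verts finite_subset by blast
  then show ?thesis using assms by (auto simp: degree_of_eq_card card_gt_0_iff)
qed

lemma (in pair_graph) randic_entry_sym: "randic_entry G u v = randic_entry G v u"
  using arcs_symmetric by (auto simp: randic_entry_def mult.commute)

text \<open>The vector \<open>v \<mapsto> sqrt (d v)\<close> is fixed by the Randic matrix. Twisting it by a function \<open>s\<close> that is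
  multiplied by \<open>t\<close> along every arc gives the eigenvalue \<open>t\<close>: the constant function yields \<open>1\<close>, the
  signs of a proper two-colouring yield \<open>-1\<close>.\<close>

lemma (in pair_graph) randic_entry_scaled_sqrt_degree:
  assumes u: "u \<in> pverts G"
    and s: "\<And>v. (u, v) \<in> parcs G \<Longrightarrow> s v = t * s u"
  shows "(\<Sum>v\<in>pverts G. randic_entry G u v * (s v * sqrt (degree_of G v))) =
    t * (s u * sqrt (degree_of G u))"
proof -
  have "randic_entry G u v * (s v * sqrt (degree_of G v)) =
    (if (u, v) \<in> parcs G then 1 else 0) * (t * s u / sqrt (degree_of G u))" for v
    using s[of v] degree_of_pos[OF arcs_symmetric, of u v]
    by (auto simp: randic_entry_def real_sqrt_mult)
  then have "(\<Sum>v\<in>pverts G. randic_entry G u v * (s v * sqrt (degree_of G v))) =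
    real (degree_of G u) * (t * s u / sqrt (degree_of G u))"
    by (simp only: degree_of_eq_sum[OF u] sum_distrib_right)
  also have "\<dots> = t * (s u * sqrt (degree_of G u))"
    by (simp add: real_div_sqrt flip: times_divide_eq_left)
  finally show ?thesis .
qed

lemma (in pair_graph) randic_eigenvalueI:
  assumes f: "bij_betw f {..<card (pverts G)} (pverts G)"
    and arc: "(a, b) \<in> parcs G" "s a \<noteq> 0"
    and s: "\<And>u v. (u, v) \<in> parcs G \<Longrightarrow> s v = t * s u"
  shows "eigenvalue (randic_matrix_wrt f G) t"
proof -
  define n where "n = card (pverts G)"
  define x where "x = (\<lambda>u. s u * sqrt (degree_of G u))"
  define y where "y = Matrix.vec n (\<lambda>i. x (f i))"
  have fV: "f i \<in> pverts G" if "i < n" for i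
    using f that by (auto simp: bij_betw_def n_def)
  have "a \<in> f ` {..<n}"
    using f in_arcsD1[OF arc(1)] by (simp add: bij_betw_def n_def)
  then obtain i where i: "i < n" "f i = a" by auto
  have "randic_matrix_wrt f G *\<^sub>v y = t \<cdot>\<^sub>v y"
  proof (rule eq_vecI)
    fix i assume "i < dim_vec (t \<cdot>\<^sub>v y)"
    then have i: "i < n" by (simp add: y_def)
    have "(randic_matrix_wrt f G *\<^sub>v y) $ i = (\<Sum>j<n. randic_entry G (f i) (f j) * x (f j))"
      using i by (simp add: randic_matrix_wrt_def y_def n_def scalar_prod_def lessThan_atLeast0)
    also have "\<dots> = (\<Sum>v\<in>pverts G. randic_entry G (f i) v * x v)"
      by (rule sum.reindex_bij_betw[OF f[folded n_def]])
    also have "\<dots> = t * x (f i)"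
      unfolding x_def using fV[OF i] s by (rule randic_entry_scaled_sqrt_degree)
    finally show "(randic_matrix_wrt f G *\<^sub>v y) $ i = (t \<cdot>\<^sub>v y) $ i" using i by (simp add: y_def)
  qed (simp add: randic_matrix_wrt_def y_def n_def)
  moreover have "y \<noteq> 0\<^sub>v n"
  proof
    assume "y = 0\<^sub>v n"
    then have "y $ i = 0" using i by simp
    then show False using i arc degree_of_pos[OF arc(1)] by (simp add: y_def x_def)
  qed
  ultimately show ?thesis
    by (auto simp: eigenvalue_def eigenvector_def randic_matrix_wrt_def y_def n_def intro!: exI[of _ y])
qed

text \<open>A matrix conjugate to its negative satisfies \<open>det A = (-1) ^ n * det A\<close>. For a bipartite graph
  the conjugating diagonal matrix holds the signs of the two colour classes, so a bipartite graph
  of odd order has the Randic eigenvalue \<open>0\<close>.\<close>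

lemma det_eq_0_if_signed_similar_neg:
  fixes A :: "real mat"
  assumes A: "A \<in> carrier_mat n n" and "odd n"
    and s: "\<And>i. i < n \<Longrightarrow> s i * s i = 1"
    and neg: "\<And>i j. i < n \<Longrightarrow> j < n \<Longrightarrow> s i * A $$ (i, j) * s j = - (A $$ (i, j))"
  shows "det A = 0"
proof -
  define S where "S = Matrix.mat n n (\<lambda>(i, j). if i = j then s i else 0)"
  have S: "S \<in> carrier_mat n n" by (simp add: S_def)
  have "S * S = 1\<^sub>m n"
    by (rule eq_matI) (auto simp: S_def scalar_prod_def if_distrib[of "\<lambda>x. x * _"] sum.delta s cong: if_cong)
  then have "det S * det S = 1" using det_mult[OF S S] by simp
  have "S * A * S = (-1) \<cdot>\<^sub>m A"
  proof (rule eq_matI)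
    fix i j assume "i < dim_row ((-1) \<cdot>\<^sub>m A)" "j < dim_col ((-1) \<cdot>\<^sub>m A)"
    then have ij: "i < n" "j < n" using A by auto
    have SA: "(S * A) $$ (i, k) = s i * A $$ (i, k)" if "k < n" for k
      using ij that A by (simp add: S_def scalar_prod_def if_distrib[of "\<lambda>x. x * _"] sum.delta cong: if_cong)
    have "(S * A * S) $$ (i, j) = (\<Sum>k = 0..<n. (S * A) $$ (i, k) * S $$ (k, j))"
      using ij A S by (simp add: scalar_prod_def del: assoc_mult_mat)
    also have "\<dots> = s i * A $$ (i, j) * s j"
      using ij by (simp add: SA) (simp add: S_def if_distrib[of "\<lambda>x. _ * x"] sum.delta' cong: if_cong)
    finally show "(S * A * S) $$ (i, j) = ((-1) \<cdot>\<^sub>m A) $$ (i, j)"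
      using ij A neg by simp
  qed (use A S in auto)
  moreover have "det (S * A * S) = det S * det A * det S"
    using det_mult[OF mult_carrier_mat[OF S A] S] det_mult[OF S A] by simp
  ultimately have "det S * det A * det S = (-1) ^ n * det A"
    by (simp only: det_smult carrier_matD(2)[OF A])
  then show ?thesis using \<open>det S * det S = 1\<close> \<open>odd n\<close> by (simp add: algebra_simps)
qed

text \<open>The list \<open>es\<close> is what remains of the spectrum after one copy each of the eigenvalues
  \<open>1\<close>, \<open>-1\<close> and \<open>0\<close> has been removed; the number \<open>2\<close> in the conclusions is their joint contribution
  to the energy and to the traces of the second and fourth power.\<close>

lemma (in pair_graph) bipartite_randic_spectrum:
  fixes colour :: "'a \<Rightarrow> bool"
  assumes "odd (card (pverts G))" and nonempty: "parcs G \<noteq> {}"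
    and colour: "\<And>u v. (u, v) \<in> parcs G \<Longrightarrow> colour u \<noteq> colour v"
  obtains es where "length es + 3 = card (pverts G)"
    and "randic_energy G = 2 + (\<Sum>e\<leftarrow>es. \<bar>e\<bar>)"
    and "2 + (\<Sum>e\<leftarrow>es. e\<^sup>2) = (\<Sum>u\<in>pverts G. \<Sum>v\<in>pverts G. (randic_entry G u v)\<^sup>2)"
    and "2 + (\<Sum>e\<leftarrow>es. e ^ 4) = (\<Sum>u\<in>pverts G. \<Sum>v\<in>pverts G.
      (\<Sum>w\<in>pverts G. randic_entry G u w * randic_entry G w v)\<^sup>2)"
proof -
  define n where "n = card (pverts G)"
  define s where "s = (\<lambda>u. if colour u then 1 else -1 :: real)"
  obtain f where f: "bij_betw f {..<n} (pverts G)"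
    using ex_bij_betw_nat_finite[OF pair_finite_verts] by (auto simp: n_def lessThan_atLeast0)
  note f' = f[unfolded n_def]
  define A where "A = randic_matrix_wrt f G"
  have A: "A \<in> carrier_mat n n" by (simp add: A_def randic_matrix_wrt_def n_def)
  have entry: "A $$ (i, j) = randic_entry G (f i) (f j)" if "i < n" "j < n" for i j
    using that by (simp add: A_def randic_matrix_wrt_def n_def)
  have sum_f: "(\<Sum>i<n. h (f i)) = (\<Sum>u\<in>pverts G. h u)" for h :: "'a \<Rightarrow> real"
    by (rule sum.reindex_bij_betw[OF f])
  obtain es where es: "char_poly A = (\<Prod>e\<leftarrow>es. [:- e, 1:])" "length es = n"
    using real_symmetric_char_poly_splits[OF A] by (metis entry randic_entry_sym)
  have mem: "x \<in> set es" if "eigenvalue A x" for x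
    using that unfolding eigenvalue_root_char_poly[OF A] es poly_prod_list
    by (auto simp: prod_list_zero_iff)
  obtain a b where ab: "(a, b) \<in> parcs G" using nonempty by auto
  have 1: "1 \<in> set es"
    using randic_eigenvalueI[OF f' ab, of "\<lambda>_. 1" 1] by (intro mem) (simp add: A_def)
  have "eigenvalue A (-1)"
    unfolding A_def using ab colour by (intro randic_eigenvalueI[OF f', where s = s]) (auto simp: s_def)
  then have m1: "-1 \<in> set es" by (rule mem)
  have "det A = 0"
  proof (rule det_eq_0_if_signed_similar_neg[OF A, where s = "\<lambda>i. s (f i)"])
    fix i j assume ij: "i < n" "j < n"
    show "s (f i) * A $$ (i, j) * s (f j) = - A $$ (i, j)"
      using colour[of "f i" "f j"] by (auto simp: entry ij s_def randic_entry_def)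
  qed (use assms(1) in \<open>auto simp: n_def s_def\<close>)
  moreover have "char_matrix A 0 = A" using A by (intro eq_matI) (auto simp: char_matrix_def)
  ultimately have "eigenvalue A 0" by (simp add: eigenvalue_det[OF A])
  then have 0: "0 \<in> set es" by (rule mem)
  define N where "N = remove1 0 (remove1 (-1) (remove1 1 es))"
  have split: "(\<Sum>e\<leftarrow>es. h e) = h 1 + h (-1) + h 0 + (\<Sum>e\<leftarrow>N. h e)" for h :: "real \<Rightarrow> real"
    unfolding N_def using 0 1 m1
    by (simp add: sum_list_map_remove1[of 1 es] sum_list_map_remove1[of "-1" "remove1 1 es"]
        sum_list_map_remove1[of 0 "remove1 (-1) (remove1 1 es)"])
  have "length N + 3 = n"
    using split[of "\<lambda>_. 1"] es(2) by (simp add: sum_list_triv)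
  moreover have "randic_energy G = (\<Sum>e\<leftarrow>es. \<bar>e\<bar>)"
  proof -
    have M: "randic_matrix G \<in> carrier_mat n n"
      by (simp add: randic_matrix_def randic_matrix_wrt_def n_def)
    have "char_poly (randic_matrix G) = (\<Prod>e\<leftarrow>es. [:- e, 1:])"
      using char_poly_randic_matrix[OF pair_finite_verts f'] es by (simp add: A_def)
    from sum_eigenvalues_weighted_by_order[OF M this] show ?thesis
      by (simp add: randic_energy_def)
  qed
  moreover have "(\<Sum>e\<leftarrow>es. e\<^sup>2) = (\<Sum>u\<in>pverts G. \<Sum>v\<in>pverts G. (randic_entry G u v)\<^sup>2)"
  proof -
    have "(\<Sum>e\<leftarrow>es. e\<^sup>2) = trace_mat (A * A)"
      using trace_pow_mat[OF A es(1), of 2] A by (simp add: numeral_2_eq_2)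
    also have "\<dots> = (\<Sum>i<n. \<Sum>j<n. (randic_entry G (f i) (f j))\<^sup>2)"
      unfolding trace_mult[OF A A]
      by (auto intro!: sum.cong simp: entry power2_eq_square randic_entry_sym)
    also have "\<dots> = (\<Sum>u\<in>pverts G. \<Sum>v\<in>pverts G. (randic_entry G u v)\<^sup>2)"
      by (simp only: sum_f[of "\<lambda>v. (randic_entry G _ v)\<^sup>2"] sum_f[of "\<lambda>u. \<Sum>v\<in>pverts G. (randic_entry G u v)\<^sup>2"])
    finally show ?thesis .
  qed
  moreover have "(\<Sum>e\<leftarrow>es. e ^ 4) = (\<Sum>u\<in>pverts G. \<Sum>v\<in>pverts G.
      (\<Sum>w\<in>pverts G. randic_entry G u w * randic_entry G w v)\<^sup>2)"
  proof -
    let ?q = "\<lambda>u v. \<Sum>w\<in>pverts G. randic_entry G u w * randic_entry G w v"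
    have q: "(A * A) $$ (i, j) = ?q (f i) (f j)" if "i < n" "j < n" for i j
      using that A
      by (simp add: scalar_prod_def entry sum_f[of "\<lambda>w. randic_entry G (f i) w * randic_entry G w (f j)", symmetric]
          lessThan_atLeast0)
    have q_sym: "?q u v = ?q v u" for u v
      by (intro sum.cong) (simp_all add: randic_entry_sym[of u] randic_entry_sym[of v] mult.commute)
    have AA: "A * A \<in> carrier_mat n n" using A by simp
    have "A ^\<^sub>m 4 = A * A * (A * A)"
      using A by (simp add: numeral_eq_Suc assoc_mult_mat[of _ n n _ n _ n])
    then have "(\<Sum>e\<leftarrow>es. e ^ 4) = trace_mat (A * A * (A * A))"
      using trace_pow_mat[OF A es(1), of 4] by simp
    also have "\<dots> = (\<Sum>i<n. \<Sum>j<n. (?q (f i) (f j))\<^sup>2)"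
      unfolding trace_mult[OF AA AA]
      by (auto intro!: sum.cong simp: q power2_eq_square q_sym)
    also have "\<dots> = (\<Sum>u\<in>pverts G. \<Sum>v\<in>pverts G. (?q u v)\<^sup>2)"
      by (simp only: sum_f[of "\<lambda>v. (?q _ v)\<^sup>2"] sum_f[of "\<lambda>u. \<Sum>v\<in>pverts G. (?q u v)\<^sup>2"])
    finally show ?thesis .
  qed
  ultimately show ?thesis
    using split[of abs] split[of "\<lambda>e. e\<^sup>2"] split[of "\<lambda>e. e ^ 4"]
    by (intro that[of N]) (simp_all add: n_def)
qed

lemma two_mult_div_sqrt_2: "2 * x / sqrt 2 = sqrt 2 * x"
  by (simp add: field_simps)

text \<open>The arithmetic-geometric mean inequality \<open>sqrt 2 * \<bar>e\<bar> \<le> e\<^sup>2 + 1 / 2\<close> is applied to every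
  eigenvalue other than \<open>1\<close>, \<open>-1\<close>, \<open>0\<close>. Its equality case \<open>\<bar>e\<bar> = 1 / sqrt 2\<close> is the spectrum of
  the sun.\<close>

lemma (in pair_graph) bipartite_randic_energy_le:
  fixes colour :: "'a \<Rightarrow> bool"
  assumes card: "card (pverts G) = 2 * p + 1" and nonempty: "parcs G \<noteq> {}"
    and colour: "\<And>u v. (u, v) \<in> parcs G \<Longrightarrow> colour u \<noteq> colour v"
    and sq: "(\<Sum>u\<in>pverts G. \<Sum>v\<in>pverts G. (randic_entry G u v)\<^sup>2) \<le> real p + 1"
  shows "randic_energy G \<le> 2 + sqrt 2 * (real p - 1)"
proof -
  have "odd (card (pverts G))" by (simp add: card)
  then obtain es :: "real list" where es: "length es + 3 = card (pverts G)"
    "randic_energy G = 2 + (\<Sum>e\<leftarrow>es. \<bar>e\<bar>)"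
    and trace: "2 + (\<Sum>e\<leftarrow>es. e\<^sup>2) = (\<Sum>u\<in>pverts G. \<Sum>v\<in>pverts G. (randic_entry G u v)\<^sup>2)"
    by (rule bipartite_randic_spectrum[OF _ nonempty colour])
  have "\<bar>e\<bar> \<le> (e\<^sup>2 + 1 / 2) / sqrt 2" for e :: real
  proof -
    have "0 \<le> (\<bar>e\<bar> - 1 / sqrt 2)\<^sup>2" by simp
    then have "2 * \<bar>e\<bar> / sqrt 2 \<le> e\<^sup>2 + 1 / 2" by (simp add: power2_diff power_divide)
    then have "sqrt 2 * \<bar>e\<bar> \<le> e\<^sup>2 + 1 / 2" by (simp only: two_mult_div_sqrt_2)
    then show ?thesis by (simp add: pos_le_divide_eq mult.commute)
  qed
  then have "(\<Sum>e\<leftarrow>es. \<bar>e\<bar>) \<le> (\<Sum>e\<leftarrow>es. (e\<^sup>2 + 1 / 2) / sqrt 2)"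
    by (intro sum_list_mono)
  also have "\<dots> = ((\<Sum>e\<leftarrow>es. e\<^sup>2) + length es / 2) / sqrt 2"
    by (induction es) (simp_all add: field_simps)
  also have "\<dots> \<le> (2 * (real p - 1)) / sqrt 2"
    using es(1) card trace sq by (intro divide_right_mono) auto
  also have "\<dots> = sqrt 2 * (real p - 1)"
    by (rule two_mult_div_sqrt_2)
  finally show ?thesis using es(2) by simp
qed

section \<open>Connected graphs and trees\<close>

text \<open>A closed walk that revisits a vertex splits into two shorter closed walks, one of which is again
  odd. Parity is what excludes the degenerate cycles that run back and forth along an edge.\<close>

lemma (in pair_graph) odd_closed_awalk_imp_cycle:
  assumes "awalk u p u" "odd (length p)"
  shows "\<exists>c. cycle c \<and> length c \<ge> 3"
  using assms
proof (induction "length p" arbitrary: u p rule: less_induct)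
  case less
  show ?case
  proof (cases "distinct (tl (awalk_verts u p))")
    case True
    have "p \<noteq> []" using less.prems(2) by auto
    then have "cycle p" using True less.prems(1) by (auto simp: cycle_def)
    moreover from this have "length p \<ge> 2" by (auto simp: cycle_digraph_conv)
    then have "length p \<ge> 3" using less.prems(2) by (cases "length p = 2") auto
    ultimately show ?thesis by blast
  next
    case False
    then obtain e es where p: "p = e # es" by (cases p) auto
    then have es: "awalk (snd e) es u" "\<not> distinct (awalk_verts (snd e) es)"
      and e: "e \<in> parcs G" "u = fst e"
      using False less.prems(1) by (auto simp: awalk_Cons_iff)
    obtain q r s w where qrs: "es = q @ r @ s" "0 < length r"
      "awalk (snd e) q w" "awalk w r w" "awalk w s u"
      using awalk_not_distinct_decomp[OF es] by blast
    show ?thesis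
    proof (cases "odd (length r)")
      case True
      then show ?thesis using less.hyps[OF _ qrs(4)] qrs(1) p by simp
    next
      case False
      have "awalk (snd e) (q @ s) u" using qrs(3,5) by (rule awalk_appendI)
      then have "awalk u (e # q @ s) u" using e by (simp add: awalk_Cons_iff)
      from less.hyps[OF _ this] show ?thesis
        using False qrs(1,2) p less.prems(2) by simp
    qed
  qed
qed

lemma (in pair_graph) connected_awalk:
  assumes "Digraph_Component.connected (with_proj G)" "u \<in> pverts G" "v \<in> pverts G"
  obtains p where "awalk u p v"
proof -
  have "u \<rightarrow>\<^sup>*\<^bsub>mk_symmetric (with_proj G)\<^esub> v"
    using assms unfolding connected_def by auto
  then have "u \<rightarrow>\<^sup>*\<^bsub>with_proj G\<^esub> v"
    using reachable_mk_symmetric_eq[OF sym_arcs] by simp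
  then show ?thesis using that by (auto simp: reachable_awalk)
qed

text \<open>Colour a vertex by the parity of the walks that reach it from a fixed root. Two such walks of
  different parity would close up to an odd closed walk.\<close>

lemma (in pair_graph) tree_two_colouring:
  assumes "is_tree G"
  obtains colour :: "'a \<Rightarrow> bool" where "\<And>u v. (u, v) \<in> parcs G \<Longrightarrow> colour u \<noteq> colour v"
proof -
  have conn: "Digraph_Component.connected (with_proj G)"
    and acyclic: "\<not> (\<exists>c. cycle c \<and> length c \<ge> 3)"
    using assms by (auto simp: is_tree_def)
  obtain r where r: "r \<in> pverts G" using conn by (auto simp: connected_def strongly_connected_def)
  have parity: "even (length p) = even (length q)" if "awalk r p v" "awalk r q v" for p q v
  proof (rule ccontr)
    assume "even (length p) \<noteq> even (length q)"
    moreover have "length (rev_path xs) = length xs" for xs :: "('a \<times> 'a) list"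
      by (induction xs) auto
    ultimately have "odd (length (p @ rev_path q))" by simp
    moreover have "awalk r (p @ rev_path q) r"
      using that by (intro awalk_appendI) auto
    ultimately show False using odd_closed_awalk_imp_cycle acyclic by blast
  qed
  define colour where "colour = (\<lambda>v. \<exists>p. awalk r p v \<and> even (length p))"
  have "colour u \<noteq> colour v" if uv: "(u, v) \<in> parcs G" for u v
  proof -
    obtain p where p: "awalk r p u" using connected_awalk[OF conn r in_arcsD1[OF uv]] .
    have "awalk u [(u, v)] v" using uv in_arcsD2 by (auto simp: awalk_simps)
    with p have pv: "awalk r (p @ [(u, v)]) v" by (rule awalk_appendI)
    have "colour u \<longleftrightarrow> even (length p)" unfolding colour_def using parity[OF p] p by blast
    moreover have "colour v \<longleftrightarrow> odd (length p)"
      unfolding colour_def using parity[OF pv] pv by (metis even_Suc length_append_singleton)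
    ultimately show ?thesis by simp
  qed
  then show ?thesis by (rule that)
qed

text \<open>The form in which connectedness is used below: it makes all degrees positive, excludes edges
  between two leaves, and lets a spanning tree grow.\<close>

lemma (in pair_graph) connected_imp_leaving_arc:
  assumes conn: "Digraph_Component.connected (with_proj G)"
    and S: "a \<in> S" "a \<in> pverts G" "b \<in> pverts G" "b \<notin> S"
  obtains u v where "(u, v) \<in> parcs G" "u \<in> S" "v \<notin> S"
proof -
  obtain p where "awalk a p b" using connected_awalk[OF conn S(2,3)] .
  then have "\<exists>u v. (u, v) \<in> parcs G \<and> u \<in> S \<and> v \<notin> S" using S(1)
  proof (induction p arbitrary: a)
    case Nil
    then show ?case using S(4) by (simp add: awalk_Nil_iff)
  next
    case (Cons e p)
    then show ?case by (cases e; cases "snd e \<in> S") (auto simp: awalk_Cons_iff)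
  qed
  then show ?thesis using that by blast
qed

text \<open>Growing a vertex set one vertex at a time along leaving arcs adds two arcs in every step. As
  every edge is a pair of arcs, this is the bound of \<open>n - 1\<close> edges.\<close>

lemma (in pair_graph) connected_imp_many_arcs:
  assumes conn: "Digraph_Component.connected (with_proj G)"
  shows "2 * card (pverts G) \<le> card (parcs G) + 2"
proof -
  obtain r where r: "r \<in> pverts G" using conn by (auto simp: connected_def strongly_connected_def)
  have "\<exists>S. r \<in> S \<and> S \<subseteq> pverts G \<and> card S = Suc k \<and> 2 * k \<le> card (parcs G \<inter> S \<times> S)"
    if "k < card (pverts G)" for k
    using that
  proof (induction k)
    case 0
    show ?case using r by (intro exI[of _ "{r}"]) auto
  next
    case (Suc k)
    then obtain S where S: "r \<in> S" "S \<subseteq> pverts G" "card S = Suc k"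
      "2 * k \<le> card (parcs G \<inter> S \<times> S)" by auto
    have "S \<noteq> pverts G" using S(3) Suc.prems by auto
    then obtain b where b: "b \<in> pverts G" "b \<notin> S" using S(2) by auto
    obtain u v where uv: "(u, v) \<in> parcs G" "u \<in> S" "v \<notin> S"
      using connected_imp_leaving_arc[OF conn S(1) r b] .
    have fin: "finite S" using S(2) pair_finite_verts finite_subset by blast
    let ?E = "parcs G \<inter> S \<times> S"
    have "finite ?E" using fin by blast
    then have "card (insert (u, v) (insert (v, u) ?E)) = card ?E + 2"
      using uv by (subst card_insert_disjoint; auto)+
    moreover have "insert (u, v) (insert (v, u) ?E) \<subseteq> parcs G \<inter> insert v S \<times> insert v S"
      using uv arcs_symmetric by auto
    then have "card (insert (u, v) (insert (v, u) ?E)) \<le> card (parcs G \<inter> insert v S \<times> insert v S)"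
      by (intro card_mono) (auto simp: fin)
    ultimately show ?case
      using S uv fin in_arcsD2[OF uv(1)] by (intro exI[of _ "insert v S"]) auto
  qed
  moreover have "card (pverts G) - 1 < card (pverts G)"
    using r pair_finite_verts card_gt_0_iff[of "pverts G"] by auto
  ultimately obtain S where S: "2 * (card (pverts G) - 1) \<le> card (parcs G \<inter> S \<times> S)"
    by blast
  have "card (parcs G \<inter> S \<times> S) \<le> card (parcs G)"
    by (intro card_mono pair_finite_arcs) auto
  then show ?thesis using S by linarith
qed

text \<open>The hypothesis on the edges says
  \<open>1 / (d u * d v) \<le> 1 / (2 * d u) + 1 / (2 * d v) - 1 / 4\<close>. Summed over all arcs, each of the first two
  terms on the right contributes \<open>n / 2\<close>, since a vertex \<open>u\<close> occurs \<open>d u\<close> times; the last one contributes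
  minus a quarter of the number of arcs, which is at least \<open>2 * (n - 1)\<close>.\<close>

lemma (in pair_graph) sum_sq_randic_le:
  assumes conn: "Digraph_Component.connected (with_proj G)"
    and pos: "\<And>u. u \<in> pverts G \<Longrightarrow> degree_of G u > 0"
    and edge: "\<And>u v. (u, v) \<in> parcs G \<Longrightarrow>
      (1 / real (degree_of G u) - 1 / 2) * (1 / real (degree_of G v) - 1 / 2) \<le> 0"
  shows "(\<Sum>u\<in>pverts G. \<Sum>v\<in>pverts G. (randic_entry G u v)\<^sup>2) \<le> (real (card (pverts G)) + 1) / 2"
proof -
  let ?V = "pverts G" and ?d = "\<lambda>u. real (degree_of G u)"
  let ?I = "\<lambda>u v. if (u, v) \<in> parcs G then 1 else 0 :: real"
  have le: "(randic_entry G u v)\<^sup>2 \<le> ?I u v * (1 / (2 * ?d u)) + ?I u v * (1 / (2 * ?d v)) - ?I u v / 4" for u v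
  proof (cases "(u, v) \<in> parcs G")
    case True
    then have "(randic_entry G u v)\<^sup>2 = 1 / ?d u * (1 / ?d v)"
      by (simp add: randic_entry_def power_divide)
    then show ?thesis using edge[OF True] True by (simp add: algebra_simps)
  qed (simp add: randic_entry_def)
  have half: "(\<Sum>u\<in>?V. \<Sum>v\<in>?V. ?I u v * (1 / (2 * ?d u))) = real (card ?V) / 2"
  proof -
    have "(\<Sum>v\<in>?V. ?I u v * (1 / (2 * ?d u))) = 1 / 2" if "u \<in> ?V" for u
      unfolding sum_distrib_right[symmetric] degree_of_eq_sum[OF that, symmetric] using pos[OF that] by simp
    then have "(\<Sum>u\<in>?V. \<Sum>v\<in>?V. ?I u v * (1 / (2 * ?d u))) = (\<Sum>u\<in>?V. 1 / 2)"
      by (intro sum.cong refl)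
    then show ?thesis by simp
  qed
  have I_sym: "?I u v = ?I v u" for u v using arcs_symmetric by auto
  have half': "(\<Sum>u\<in>?V. \<Sum>v\<in>?V. ?I u v * (1 / (2 * ?d v))) = real (card ?V) / 2"
    unfolding half[symmetric] by (subst sum.swap) (intro sum.cong refl arg_cong2[of _ _ _ _ "(*)"] I_sym)
  have "parcs G \<subseteq> ?V \<times> ?V" using in_arcsD1 in_arcsD2 by auto
  then have arcs: "(\<Sum>u\<in>?V. \<Sum>v\<in>?V. ?I u v / 4) = real (card (parcs G)) / 4"
    unfolding sum_divide_distrib[symmetric] sum.cartesian_product
    by (simp add: case_prod_beta pair_finite_verts sum.If_cases Int_absorb1)
  have "(\<Sum>u\<in>?V. \<Sum>v\<in>?V. (randic_entry G u v)\<^sup>2) \<le>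
    (\<Sum>u\<in>?V. \<Sum>v\<in>?V. ?I u v * (1 / (2 * ?d u)) + ?I u v * (1 / (2 * ?d v)) - ?I u v / 4)"
    by (intro sum_mono le)
  also have "\<dots> = real (card ?V) - real (card (parcs G)) / 4"
    by (simp only: sum.distrib sum_subtractf half half' arcs) 
  also have "\<dots> \<le> (real (card ?V) + 1) / 2"
    using connected_imp_many_arcs[OF conn] by simp
  finally show ?thesis .
qed

section \<open>The energy of the sun\<close>

lemma sun_graph_pair_graph: "pair_graph (sun_graph p)"
  by unfold_locales
    (auto simp: sun_graph_explicit symmetric_def with_proj_def arcs_ends_def arc_to_ends_def intro!: symI)

lemma sum_sun_verts:
  fixes h :: "nat \<Rightarrow> real"
  shows "(\<Sum>v\<in>pverts (sun_graph p). h v) = h 0 + (\<Sum>i\<in>{1..p}. h i) + (\<Sum>i\<in>{1..p}. h (p + i))"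
proof -
  have "pverts (sun_graph p) = insert 0 ({1..p} \<union> (+) p ` {1..p})"
    unfolding image_add_atLeastAtMost by (auto simp: sun_graph_explicit)
  also have "sum h \<dots> = h 0 + (sum h {1..p} + sum h ((+) p ` {1..p}))"
    by (subst sum.insert, simp, force, subst sum.union_disjoint) auto
  also have "sum h ((+) p ` {1..p}) = (\<Sum>i\<in>{1..p}. h (p + i))"
    by (subst sum.reindex) auto
  finally show ?thesis by simp
qed

context
  fixes p :: nat and r q :: "nat \<Rightarrow> nat \<Rightarrow> real"
  assumes p: "p \<ge> 1"
  defines "r \<equiv> randic_entry (sun_graph p)"
    and "q \<equiv> \<lambda>u v. \<Sum>w\<in>pverts (sun_graph p). r u w * r w v"
begin

lemma degree_sun:
  "degree_of (sun_graph p) 0 = p"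
  "i \<in> {1..p} \<Longrightarrow> degree_of (sun_graph p) i = 1"
  "i \<in> {1..p} \<Longrightarrow> degree_of (sun_graph p) (p + i) = 2"
proof -
  have "{v. (0, v) \<in> parcs (sun_graph p)} = (+) p ` {1..p}"
    by (auto simp: sun_graph_explicit simp del: image_add_atLeastAtMost)
  then show "degree_of (sun_graph p) 0 = p" by (simp add: degree_of_eq_card card_image)
  assume i: "i \<in> {1..p}"
  have "{v. (i, v) \<in> parcs (sun_graph p)} = {p + i}"
    using i by (auto simp: sun_graph_explicit)
  then show "degree_of (sun_graph p) i = 1" by (simp add: degree_of_eq_card)
  have "{v. (p + i, v) \<in> parcs (sun_graph p)} = {0, i}"
    using i by (auto simp: sun_graph_explicit)
  then show "degree_of (sun_graph p) (p + i) = 2" using i by (simp add: degree_of_eq_card)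
qed

lemma randic_entry_sun:
  "r 0 0 = 0"
  "j \<in> {1..p} \<Longrightarrow> r 0 j = 0"
  "j \<in> {1..p} \<Longrightarrow> r 0 (p + j) = 1 / sqrt (2 * p)"
  "i \<in> {1..p} \<Longrightarrow> r i 0 = 0"
  "i \<in> {1..p} \<Longrightarrow> j \<in> {1..p} \<Longrightarrow> r i j = 0"
  "i \<in> {1..p} \<Longrightarrow> j \<in> {1..p} \<Longrightarrow> r i (p + j) = (if i = j then 1 / sqrt 2 else 0)"
  "i \<in> {1..p} \<Longrightarrow> r (p + i) 0 = 1 / sqrt (2 * p)"
  "i \<in> {1..p} \<Longrightarrow> j \<in> {1..p} \<Longrightarrow> r (p + i) j = (if i = j then 1 / sqrt 2 else 0)"
  "i \<in> {1..p} \<Longrightarrow> j \<in> {1..p} \<Longrightarrow> r (p + i) (p + j) = 0"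
proof -
  have sym: "r u v = r v u" for u v
    unfolding r_def by (rule pair_graph.randic_entry_sym[OF sun_graph_pair_graph])
  show "r 0 0 = 0" by (simp add: r_def randic_entry_def sun_graph_explicit)
  show c: "r 0 j = 0" "r 0 (p + j) = 1 / sqrt (2 * p)" if "j \<in> {1..p}" for j
    using that by (auto simp: r_def randic_entry_def degree_sun mult.commute) (auto simp: sun_graph_explicit)
  then show "r i 0 = 0" "r (p + i) 0 = 1 / sqrt (2 * p)" if "i \<in> {1..p}" for i
    using that by (simp_all add: sym[of _ 0])
  show "r i j = 0" "r (p + i) (p + j) = 0" if "i \<in> {1..p}" "j \<in> {1..p}" for i j
    using that by (auto simp: r_def randic_entry_def sun_graph_explicit)
  show l: "r i (p + j) = (if i = j then 1 / sqrt 2 else 0)" if "i \<in> {1..p}" "j \<in> {1..p}" for i j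
    using that by (auto simp: r_def randic_entry_def degree_sun) (auto simp: sun_graph_explicit)
  then show "r (p + i) j = (if i = j then 1 / sqrt 2 else 0)" if "i \<in> {1..p}" "j \<in> {1..p}" for i j
    using that by (simp add: sym[of "p + i"])
qed

lemma sum_randic_sun_sq:
  "(\<Sum>u\<in>pverts (sun_graph p). \<Sum>v\<in>pverts (sun_graph p). (r u v)\<^sup>2) = real p + 1"
  using p by (simp add: sum_sun_verts randic_entry_sun sum.distrib power_divide if_distrib[of "\<lambda>x. x\<^sup>2"] cong: if_cong)

text \<open>Apart from the row and column of the center \<open>0\<close>, the square of the Randic matrix is half the
  identity plus the constant \<open>1 / (2 * p)\<close> on the block of the subdividing vertices.\<close>

lemma randic_sq_entry_sun:
  "q 0 0 = 1 / 2"
  "j \<in> {1..p} \<Longrightarrow> q 0 j = 1 / (2 * sqrt p)"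
  "j \<in> {1..p} \<Longrightarrow> q 0 (p + j) = 0"
  "i \<in> {1..p} \<Longrightarrow> q i 0 = 1 / (2 * sqrt p)"
  "i \<in> {1..p} \<Longrightarrow> j \<in> {1..p} \<Longrightarrow> q i j = (if i = j then 1 / 2 else 0)"
  "i \<in> {1..p} \<Longrightarrow> j \<in> {1..p} \<Longrightarrow> q i (p + j) = 0"
  "i \<in> {1..p} \<Longrightarrow> q (p + i) 0 = 0"
  "i \<in> {1..p} \<Longrightarrow> j \<in> {1..p} \<Longrightarrow> q (p + i) j = 0"
  "i \<in> {1..p} \<Longrightarrow> j \<in> {1..p} \<Longrightarrow> q (p + i) (p + j) = 1 / (2 * p) + (if i = j then 1 / 2 else 0)"
proof -
  have "sqrt 2 * sqrt p * (sqrt 2 * sqrt p) = 2 * p" by (simp flip: real_sqrt_mult)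
  then show "q 0 0 = 1 / 2"
    "j \<in> {1..p} \<Longrightarrow> q 0 j = 1 / (2 * sqrt p)"
    "j \<in> {1..p} \<Longrightarrow> q 0 (p + j) = 0"
    "i \<in> {1..p} \<Longrightarrow> q i 0 = 1 / (2 * sqrt p)"
    "i \<in> {1..p} \<Longrightarrow> j \<in> {1..p} \<Longrightarrow> q i j = (if i = j then 1 / 2 else 0)"
    "i \<in> {1..p} \<Longrightarrow> j \<in> {1..p} \<Longrightarrow> q i (p + j) = 0"
    "i \<in> {1..p} \<Longrightarrow> q (p + i) 0 = 0"
    "i \<in> {1..p} \<Longrightarrow> j \<in> {1..p} \<Longrightarrow> q (p + i) j = 0"
    "i \<in> {1..p} \<Longrightarrow> j \<in> {1..p} \<Longrightarrow> q (p + i) (p + j) = 1 / (2 * p) + (if i = j then 1 / 2 else 0)"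
    using p by (simp_all add: q_def sum_sun_verts randic_entry_sun if_distrib[of "\<lambda>x. x * _"]
        if_distrib[of "\<lambda>x. _ * x"] if_distrib[of "\<lambda>x. x / _"] real_sqrt_mult cong: if_cong)
qed

lemma sum_randic_sun_pow4:
  "(\<Sum>u\<in>pverts (sun_graph p). \<Sum>v\<in>pverts (sun_graph p). (q u v)\<^sup>2) = (real p + 3) / 2"
proof -
  have "(\<Sum>j\<in>{1..p}. (1 / (2 * real p) + (if i = j then 1 / 2 else 0))\<^sup>2) = 3 / (4 * p) + 1 / 4"
    if "i \<in> {1..p}" for i
  proof -
    have "(\<Sum>j\<in>{1..p}. (1 / (2 * real p) + (if i = j then 1 / 2 else 0))\<^sup>2) =
      (\<Sum>j\<in>{1..p}. 1 / (2 * real p) ^ 2 + (if i = j then 1 / (2 * p) + 1 / 4 else 0))"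
      by (intro sum.cong) (auto simp: power2_sum power_divide)
    also have "\<dots> = 3 / (4 * p) + 1 / 4"
      using p that by (simp add: sum.distrib) (simp add: field_simps power2_eq_square)
    finally show ?thesis .
  qed
  then show ?thesis
    using p by (simp add: sum_sun_verts randic_sq_entry_sun sum.distrib power_divide power_mult_distrib
      if_distrib[of "\<lambda>x. x\<^sup>2"] cong: if_cong) (simp add: field_simps)
qed

end

text \<open>The \<open>2 * p - 2\<close> eigenvalues other than \<open>1\<close>, \<open>-1\<close>, \<open>0\<close> have \<open>p - 1\<close> as sum of squares and
  \<open>(p - 1) / 2\<close> as sum of fourth powers. Hence the nonnegative numbers \<open>(e\<^sup>2 - 1 / 2)\<^sup>2\<close> sum to zero, and
  every one of these eigenvalues has absolute value \<open>1 / sqrt 2\<close>.\<close>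

lemma randic_energy_sun:
  assumes p: "p \<ge> 1"
  shows "randic_energy (sun_graph p) = 2 + sqrt 2 * (real p - 1)"
proof -
  interpret pair_graph "sun_graph p" by (rule sun_graph_pair_graph)
  have card: "card (pverts (sun_graph p)) = 2 * p + 1" by (simp add: sun_graph_explicit)
  have arc: "(0, p + 1) \<in> parcs (sun_graph p)" using p by (auto simp: sun_graph_explicit)
  have colour: "(p < u) \<noteq> (p < v)" if "(u, v) \<in> parcs (sun_graph p)" for u v
    using that by (auto simp: sun_graph_explicit)
  have "odd (card (pverts (sun_graph p)))" "parcs (sun_graph p) \<noteq> {}" using card arc by auto
  then obtain es :: "real list" where es: "length es + 3 = card (pverts (sun_graph p))"
    "randic_energy (sun_graph p) = 2 + (\<Sum>e\<leftarrow>es. \<bar>e\<bar>)"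
    and traces: "2 + (\<Sum>e\<leftarrow>es. e\<^sup>2) = real p + 1" "2 + (\<Sum>e\<leftarrow>es. e ^ 4) = (real p + 3) / 2"
    unfolding sum_randic_sun_sq[OF p, symmetric] sum_randic_sun_pow4[OF p, symmetric]
    by (rule bipartite_randic_spectrum[of "\<lambda>v. p < v", OF _ _ colour])
  have "(\<Sum>e\<leftarrow>es. (e\<^sup>2 - 1 / 2)\<^sup>2) = (\<Sum>e\<leftarrow>es. e ^ 4) - (\<Sum>e\<leftarrow>es. e\<^sup>2) + length es / 4"
    by (induction es) (simp_all add: power2_diff field_simps flip: power_mult)
  also have "\<dots> = 0" using es(1) traces by (simp add: card)
  finally have "\<forall>x\<in>set (map (\<lambda>e. (e\<^sup>2 - 1 / 2)\<^sup>2) es). x = 0"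
    by (subst (asm) sum_list_nonneg_eq_0_iff) auto
  then have sq: "e\<^sup>2 = 1 / 2" if "e \<in> set es" for e
    using that by auto
  have "\<bar>e\<bar> = 1 / sqrt 2" if "e \<in> set es" for e
    using arg_cong[OF sq[OF that], of sqrt] unfolding real_sqrt_abs real_sqrt_divide by simp
  then have "(\<Sum>e\<leftarrow>es. \<bar>e\<bar>) = (\<Sum>e\<leftarrow>es. 1 / sqrt 2)"
    by (intro arg_cong[of _ _ sum_list] map_cong) auto
  also have "\<dots> = length es / sqrt 2" by (simp add: sum_list_triv)
  also have "real (length es) = 2 * (real p - 1)" using es(1) by (simp add: card)
  also have "2 * (real p - 1) / sqrt 2 = sqrt 2 * (real p - 1)" by (rule two_mult_div_sqrt_2)
  finally show ?thesis using es(2) by simp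
qed

section \<open>Starlike trees\<close>

theorem mainTheorem6:
  fixes T :: "'a pair_pre_digraph" and p :: nat
  assumes "starlike_tree T"
    and "card (pverts T) = 2 * p + 1"
  shows "randic_energy T \<le> randic_energy (sun_graph p)"
proof -
  have tree: "is_tree T" and "pair_graph T" and conn: "Digraph_Component.connected (with_proj T)"
    using assms(1) by (auto simp: starlike_tree_def is_tree_def)
  interpret pair_graph T by fact
  obtain c where c: "c \<in> pverts T" "degree_of T c > 2"
    and unique: "\<And>u. u \<in> pverts T \<Longrightarrow> degree_of T u > 2 \<Longrightarrow> u = c"
    using assms(1) by (auto simp: starlike_tree_def)
  have "{v. (c, v) \<in> parcs T} \<noteq> {}" using c(2) unfolding degree_of_eq_card by (metis card.empty not_less_zero)
  then obtain b where arc: "(c, b) \<in> parcs T" by auto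
  have "p \<noteq> 0"
  proof
    assume "p = 0"
    then have "card (pverts T) = 1" using assms(2) by simp
    then show False using arc in_arcsD1 in_arcsD2 no_loops' by (metis card_1_singletonE singletonD)
  qed
  then have p: "p \<ge> 1" by simp
  have pos: "degree_of T u > 0" if "u \<in> pverts T" for u
  proof (cases "u = c")
    case False
    from connected_imp_leaving_arc[OF conn, of u "{u}" c] that c False
    show ?thesis using degree_of_pos by auto
  qed (use c in simp)
  \<comment> \<open>An edge violates this only if it joins two leaves or two vertices of degree greater than two.\<close>
  have edge: "(1 / real (degree_of T u) - 1 / 2) * (1 / real (degree_of T v) - 1 / 2) \<le> 0"
    if uv: "(u, v) \<in> parcs T" for u v
  proof -
    have V: "u \<in> pverts T" "v \<in> pverts T" "u \<noteq> v"
      using uv in_arcsD1 in_arcsD2 no_loops' by auto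
    have "\<not> (degree_of T u = 1 \<and> degree_of T v = 1)"
    proof
      assume deg: "degree_of T u = 1 \<and> degree_of T v = 1"
      have "{w. (x, w) \<in> parcs T} = {y}" if "degree_of T x = 1" "(x, y) \<in> parcs T" for x y
        using that unfolding degree_of_eq_card by (metis card_1_singletonE mem_Collect_eq singletonD)
      then have N: "{w. (u, w) \<in> parcs T} = {v}" "{w. (v, w) \<in> parcs T} = {u}"
        using deg uv arcs_symmetric[OF uv] by blast+
      have "c \<notin> {u, v}" using deg c(2) by auto
      \<comment> \<open>Two adjacent leaves are cut off from the center.\<close>
      then obtain x y where "(x, y) \<in> parcs T" "x \<in> {u, v}" "y \<notin> {u, v}"
        using connected_imp_leaving_arc[OF conn, of u "{u, v}" c] V c(1) by blast
      then show False using N by blast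
    qed
    moreover have "\<not> (degree_of T u > 2 \<and> degree_of T v > 2)" using unique V by blast
    moreover have "1 / real d - 1 / 2 \<le> 0" if "d \<ge> 2" for d :: nat
      using that by (simp add: field_simps)
    moreover have "1 / real d - 1 / 2 \<ge> 0" if "d = 1 \<or> d = 2" for d :: nat
      using that by auto
    moreover have "degree_of T u = 1 \<or> degree_of T u = 2 \<or> degree_of T u > 2"
      "degree_of T v = 1 \<or> degree_of T v = 2 \<or> degree_of T v > 2"
      using pos[OF V(1)] pos[OF V(2)] by auto
    ultimately show ?thesis unfolding mult_le_0_iff by (metis less_imp_le order_refl)
  qed
  obtain colour :: "'a \<Rightarrow> bool" where colour: "\<And>u v. (u, v) \<in> parcs T \<Longrightarrow> colour u \<noteq> colour v"
    using tree_two_colouring[OF tree] by blast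
  have "(\<Sum>u\<in>pverts T. \<Sum>v\<in>pverts T. (randic_entry T u v)\<^sup>2) \<le> real p + 1"
    using sum_sq_randic_le[OF conn pos edge] assms(2) by simp
  then have "randic_energy T \<le> 2 + sqrt 2 * (real p - 1)"
    using arc by (intro bipartite_randic_energy_le[OF assms(2) _ colour]) auto
  then show ?thesis by (simp add: randic_energy_sun[OF p])
qed

end
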